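(* Let $n$ be a nonnegative integer. The polynomials $$d_{j,n}(t):=\sum_{i=j}^n\Phi_{i,j}L_{i,n}(t)\qquad(j=0,1,\ldots,n),$$ where $$\Phi_{i,j}:=(2i+1)(-i)_j(i+1)_j(j!)^{-2},$$ form the dual basis for the power basis $1,t,\ldots,t^n$ of the space $\Pi_n$ of polynomials of degree at most $n$ with respect to the inner product $\langle f,g\rangle_L=\int_0^1f(t)g(t)\,dt$; that is, they span $\Pi_n$ and $$\left\langle t^i,\,d_{j,n}\right\rangle_L=\delta_{i,j}\qquad(i,j=0,1,\ldots,n).$$
   Context: $L_{i,n}(t)=\frac{1}{i!}\frac{d^i}{dt^i}\big[(1-t)^it^i\big]$ $(i=0,1,\ldots,n)$ are the shifted Legendre polynomials. Pochhammer symbol: $(h)_0=1$, $(h)_k=h(h+1)\cdots(h+k-1)$. $\delta_{i,j}$ is the Kronecker delta. *)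

theory Defs
  imports "HOL-Analysis.Analysis" "HOL-Computational_Algebra.Polynomial"
begin

(* Often written L_{i,n}; the second index only records the ambient degree bound,
   the polynomial itself does not depend on it.  Normalised by L_i(0) = 1,
   i.e. this is the Legendre polynomial P_i(1 - 2t). *)
definition shifted_legendre :: "nat \<Rightarrow> real poly" where
  "shifted_legendre i =
     smult (1 / fact i) ((pderiv ^^ i) ([:1, -1:] ^ i * [:0, 1:] ^ i))"

definition Phi :: "nat \<Rightarrow> nat \<Rightarrow> real" where
  "Phi i j = (2 * real i + 1) * pochhammer (- real i) j * pochhammer (real i + 1) j
               / (fact j)\<^sup>2"

definition dual_power :: "nat \<Rightarrow> nat \<Rightarrow> real poly" where
  "dual_power n j = (\<Sum>i = j..n. smult (Phi i j) (shifted_legendre i))"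

definition legendre_inner :: "real poly \<Rightarrow> real poly \<Rightarrow> real" where
  "legendre_inner f g = integral {0..1} (\<lambda>t. poly f t * poly g t)"

definition polys_upto :: "nat \<Rightarrow> real poly set" where
  "polys_upto n = {p. degree p \<le> n}"

(* Independence of the indexed family b_0, ..., b_n needs injectivity of b in addition
   to independence of its set of values. *)
definition is_basis :: "real poly set \<Rightarrow> nat \<Rightarrow> (nat \<Rightarrow> real poly) \<Rightarrow> bool" where
  "is_basis V n b \<longleftrightarrow>
     inj_on b {..n} \<and> \<not> module.dependent smult (b ` {..n}) \<and>
     module.span smult (b ` {..n}) = V"

definition is_dual_basis ::
  "(real poly \<Rightarrow> real poly \<Rightarrow> real) \<Rightarrow> real poly set \<Rightarrow> nat \<Rightarrow>
   (nat \<Rightarrow> real poly) \<Rightarrow> (nat \<Rightarrow> real poly) \<Rightarrow> bool" where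
  "is_dual_basis ip V n b d \<longleftrightarrow>
     is_basis V n b \<and> is_basis V n d \<and>
     (\<forall>i\<le>n. \<forall>j\<le>n. ip (b i) (d j) = (if i = j then 1 else 0))"

end

theory Submission
  imports Defs
begin

text \<open>
  Up to the factor \<open>2 * i + 1\<close>, the number \<open>Phi i j\<close> is the coefficient of \<open>t ^ j\<close> in the
  \<open>i\<close>-th shifted Legendre polynomial. Hence
  \[ \sum_{j \le n} s^j d_{j,n}(t) = \sum_{i \le n} (2i+1) L_i(s) L_i(t), \]
  and since the \<open>L_i\<close> are orthogonal with squared norm \<open>1 / (2 * i + 1)\<close>, the right-hand side is
  the reproducing kernel of the polynomials of degree at most \<open>n\<close>. Integrating a polynomial \<open>f\<close>
  against it returns \<open>f s\<close>; comparing coefficients of \<open>s ^ j\<close>, integrating \<open>f\<close> against \<open>d_j\<close>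
  returns the coefficient of \<open>t ^ j\<close> in \<open>f\<close> (\<open>legendre_inner_dual_power\<close>). For \<open>f\<close> a power of
  \<open>t\<close> this is the duality relation.

  Orthogonality comes from Rodrigues' formula and integration by parts. The norm needs no Beta
  integral: \<open>t * L_i'\<close> differs from \<open>i * L_i\<close> by a polynomial of degree below \<open>i\<close>, so that
  integrating the derivative of \<open>t * L_i^2\<close> over the unit interval gives \<open>2 * i + 1\<close> times the
  squared norm, while the boundary value is \<open>L_i(1)^2 = 1\<close>.

  Duality makes the \<open>d_j\<close> linearly independent, and \<open>n + 1\<close> independent vectors in a space
  spanned by \<open>n + 1\<close> vectors span it.
\<close>

section \<open>The inner product and integration by parts\<close>

lemma integrable_poly: "poly (p :: real poly) integrable_on {0..1}"
  by (intro integrable_continuous_interval continuous_intros)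

lemma legendre_inner_eq_integral_mult: "legendre_inner f g = integral {0..1} (poly (f * g))"
  unfolding legendre_inner_def by (intro arg_cong[where f = "integral {0..1}"] ext) simp

lemma legendre_inner_commute: "legendre_inner f g = legendre_inner g f"
  by (simp add: legendre_inner_eq_integral_mult mult.commute)

lemma legendre_inner_add_right:
  "legendre_inner f (g + h) = legendre_inner f g + legendre_inner f h"
proof -
  have "poly (f * (g + h)) = (\<lambda>t. poly (f * g) t + poly (f * h) t)"
    by (intro ext) (simp add: algebra_simps)
  then show ?thesis
    unfolding legendre_inner_eq_integral_mult
    by (simp only: integral_add[OF integrable_poly integrable_poly])
qed

lemma legendre_inner_smult_right: "legendre_inner f (smult c g) = c * legendre_inner f g"
proof -
  have "poly (f * smult c g) = (\<lambda>t. c * poly (f * g) t)"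
    by (intro ext) simp
  then show ?thesis
    unfolding legendre_inner_eq_integral_mult by (simp only: integral_mult_right)
qed

lemma legendre_inner_0_right [simp]: "legendre_inner f 0 = 0"
  by (simp add: legendre_inner_def)

lemma legendre_inner_sum_right:
  "legendre_inner f (\<Sum>i\<in>A. g i) = (\<Sum>i\<in>A. legendre_inner f (g i))"
  by (induction A rule: infinite_finite_induct) (simp_all add: legendre_inner_add_right)

lemma legendre_inner_add_left:
  "legendre_inner (f + g) h = legendre_inner f h + legendre_inner g h"
  by (metis legendre_inner_commute legendre_inner_add_right)

lemma legendre_inner_0_left [simp]: "legendre_inner 0 f = 0"
  by (simp add: legendre_inner_def)

lemma legendre_inner_smult_left: "legendre_inner (smult c f) g = c * legendre_inner f g"
  by (metis legendre_inner_commute legendre_inner_smult_right)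

lemma integral_pderiv: "integral {0..1} (poly (pderiv p)) = poly p 1 - poly (p :: real poly) 0"
proof (rule integral_unique, rule fundamental_theorem_of_calculus)
  show "(poly p has_vector_derivative poly (pderiv p) x) (at x within {0..1})" for x
    by (metis poly_DERIV DERIV_subset subset_UNIV has_real_derivative_iff_has_vector_derivative)
qed simp

lemma legendre_inner_pderiv_right:
  "legendre_inner f (pderiv g)
     = poly (f * g) 1 - poly (f * g) 0 - legendre_inner (pderiv f) g"
proof -
  have "poly (pderiv (f * g)) = (\<lambda>t. poly (f * pderiv g) t + poly (pderiv f * g) t)"
    by (intro ext) (simp add: pderiv_mult algebra_simps)
  then have "integral {0..1} (poly (pderiv (f * g)))
      = legendre_inner f (pderiv g) + legendre_inner (pderiv f) g"
    unfolding legendre_inner_eq_integral_mult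
    by (simp only: integral_add[OF integrable_poly integrable_poly])
  then show ?thesis by (simp add: integral_pderiv)
qed

text \<open>The hypotheses on \<open>g\<close> make all boundary terms of the repeated integration by parts vanish.\<close>

lemma legendre_inner_higher_pderiv_right:
  assumes "\<And>m. m < k \<Longrightarrow> poly ((pderiv ^^ m) g) 0 = 0"
    and "\<And>m. m < k \<Longrightarrow> poly ((pderiv ^^ m) g) 1 = 0"
  shows "legendre_inner f ((pderiv ^^ k) g) = (-1) ^ k * legendre_inner ((pderiv ^^ k) f) g"
  using assms
proof (induction k arbitrary: f)
  case (Suc k)
  have "legendre_inner f ((pderiv ^^ Suc k) g) = - legendre_inner (pderiv f) ((pderiv ^^ k) g)"
    using Suc.prems by (simp add: legendre_inner_pderiv_right)
  also have "\<dots> = (-1) ^ Suc k * legendre_inner ((pderiv ^^ Suc k) f) g"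
    using Suc.IH[of "pderiv f"] Suc.prems by (simp add: funpow_swap1)
  finally show ?case .
qed simp

section \<open>Coefficients and boundary values of the shifted Legendre polynomials\<close>

text \<open>The polynomial \<open>(1 - t) ^ i * t ^ i\<close> of Rodrigues' formula is invariant under the
  reflection of the unit interval. Reflection therefore carries everything known at \<open>0\<close>, where
  values can be read off from coefficients, to the other end point.\<close>

lemma higher_pderiv_pcompose_reflect:
  "(pderiv ^^ m) (pcompose p [:1, -1:])
     = smult ((-1) ^ m) (pcompose ((pderiv ^^ m) (p :: real poly)) [:1, -1:])"
proof (induction m)
  case (Suc m)
  have "(pderiv ^^ Suc m) (pcompose p [:1, -1:])
      = smult ((-1) ^ m) (pderiv (pcompose ((pderiv ^^ m) p) [:1, -1:]))"
    by (simp add: Suc.IH pderiv_smult)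
  then show ?case by (simp add: pderiv_pcompose pderiv_pCons)
qed simp

lemma higher_pderiv_at_1_if_symmetric:
  assumes "pcompose p [:1, -1:] = (p :: real poly)"
  shows "poly ((pderiv ^^ m) p) 1 = (-1) ^ m * poly ((pderiv ^^ m) p) 0"
proof -
  have "poly ((pderiv ^^ m) p) 1 = poly ((pderiv ^^ m) (pcompose p [:1, -1:])) 1"
    by (simp only: assms)
  also have "\<dots> = (-1) ^ m * poly ((pderiv ^^ m) p) 0"
    by (simp add: higher_pderiv_pcompose_reflect poly_pcompose)
  finally show ?thesis .
qed

lemma rodrigues_symmetric:
  "pcompose ([:1, -1:] ^ i * [:0, 1:] ^ i) [:1, -1:] = ([:1, -1:] ^ i * [:0, 1:] ^ i :: real poly)"
  by (rule poly_eq_poly_eq_iff[THEN iffD1], rule ext) (simp add: poly_pcompose mult.commute)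

lemma coeff_rodrigues:
  "coeff ([:1, -1:] ^ i * [:0, 1:] ^ i :: real poly) m
     = (if m < i then 0 else (-1) ^ (m - i) * real (i choose (m - i)))"
proof -
  have "coeff ([:1, -1:] ^ i :: real poly) k = (-1) ^ k * real (i choose k)" for k
    by (cases "k \<le> i") (simp_all add: coeff_linear_poly_power coeff_eq_0)
  moreover have "[:1, -1:] ^ i * [:0, 1:] ^ i = monom 1 i * ([:1, -1:] ^ i :: real poly)"
    by (simp only: monom_altdef smult_1_left mult.commute)
  ultimately show ?thesis by (simp only: coeff_monom_mult mult_1_left)
qed

lemma higher_pderiv_rodrigues_at_0:
  "m < i \<Longrightarrow> poly ((pderiv ^^ m) ([:1, -1:] ^ i * [:0, 1:] ^ i :: real poly)) 0 = 0"
  by (simp add: poly_0_coeff_0 coeff_higher_pderiv coeff_rodrigues del: mult_pCons_left mult_pCons_right)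

text \<open>Differentiating Rodrigues' formula term by term yields
  \<open>(-1) ^ k * (i choose k) * (i + k choose k)\<close>; the first two factors together are
  \<open>pochhammer (- i) k / fact k\<close>, the third is \<open>pochhammer (i + 1) k / fact k\<close>.\<close>

lemma coeff_shifted_legendre:
  "coeff (shifted_legendre i) k
     = pochhammer (- real i) k * pochhammer (real i + 1) k / (fact k)\<^sup>2"
proof -
  have "fact k * pochhammer (1 + real k) i = fact i * pochhammer (1 + real i) k"
    by (metis add.commute pochhammer_fact pochhammer_product')
  then have shift: "pochhammer (1 + real k) i / fact i = pochhammer (1 + real i) k / fact k"
    by (simp add: field_simps)
  have "coeff (shifted_legendre i) k
      = pochhammer (1 + real k) i / fact i * ((-1) ^ k * real (i choose k))"
    unfolding shifted_legendre_def coeff_smult coeff_higher_pderiv coeff_rodrigues by simp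
  also have "\<dots> = pochhammer (1 + real i) k / fact k * (pochhammer (- real i) k / fact k)"
    unfolding shift by (simp add: binomial_gbinomial gbinomial_pochhammer flip: power_mult_distrib)
  finally show ?thesis by (simp add: power2_eq_square add.commute)
qed

lemma Phi_eq_coeff: "Phi i j = (2 * real i + 1) * coeff (shifted_legendre i) j"
  by (simp add: Phi_def coeff_shifted_legendre)

lemma coeff_shifted_legendre_eq_0_iff: "coeff (shifted_legendre i) k = 0 \<longleftrightarrow> i < k"
proof -
  have "pochhammer (real i + 1) k \<noteq> 0"
    by (intro less_imp_neq[THEN not_sym] pochhammer_pos) simp
  then show ?thesis by (simp add: coeff_shifted_legendre pochhammer_of_nat_eq_0_iff)
qed

lemma degree_shifted_legendre: "degree (shifted_legendre i) = i"
  by (intro antisym degree_le le_degree) (simp_all add: coeff_shifted_legendre_eq_0_iff)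

lemma shifted_legendre_at_1: "poly (shifted_legendre i) 1 = (-1) ^ i"
proof -
  have "poly (shifted_legendre i) 1 = (-1) ^ i * poly (shifted_legendre i) 0"
    unfolding shifted_legendre_def
    using higher_pderiv_at_1_if_symmetric[OF rodrigues_symmetric[of i], of i] by simp
  also have "poly (shifted_legendre i) 0 = 1"
    by (simp add: poly_0_coeff_0 coeff_shifted_legendre)
  finally show ?thesis by simp
qed

section \<open>Orthogonality\<close>

lemma legendre_inner_shifted_legendre_low_degree:
  assumes "degree f < i"
  shows "legendre_inner f (shifted_legendre i) = 0"
proof -
  have "(pderiv ^^ i) f = 0"
    using assms by (intro poly_eqI) (simp add: coeff_higher_pderiv coeff_eq_0)
  then have "legendre_inner f ((pderiv ^^ i) ([:1, -1:] ^ i * [:0, 1:] ^ i)) = 0"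
    by (subst legendre_inner_higher_pderiv_right)
       (simp_all add: higher_pderiv_at_1_if_symmetric[OF rodrigues_symmetric]
          higher_pderiv_rodrigues_at_0
          del: mult_pCons_left mult_pCons_right)
  then show ?thesis
    unfolding shifted_legendre_def legendre_inner_smult_right by simp
qed

text \<open>Since \<open>f - c * L_i\<close> has degree below \<open>i\<close>, orthogonality to lower degrees leaves only the
  contribution of the leading coefficient.\<close>

lemma legendre_inner_shifted_legendre_top:
  assumes "degree f \<le> i" "coeff f i = c * coeff (shifted_legendre i) i"
  shows "legendre_inner f (shifted_legendre i)
    = c * legendre_inner (shifted_legendre i) (shifted_legendre i)"
proof (cases "f = smult c (shifted_legendre i)")
  case False
  define r where "r = f - smult c (shifted_legendre i)"
  have "degree r < i"
  proof -
    have "degree r \<le> i"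
      unfolding r_def using assms(1) by (intro degree_diff_le) (auto simp: degree_shifted_legendre)
    moreover have "coeff r i = 0" "r \<noteq> 0"
      using assms(2) False by (auto simp: r_def)
    ultimately show ?thesis
      by (metis le_neq_implies_less leading_coeff_0_iff)
  qed
  moreover have "f = smult c (shifted_legendre i) + r" by (simp add: r_def)
  ultimately show ?thesis
    by (simp add: legendre_inner_add_left legendre_inner_smult_left
          legendre_inner_shifted_legendre_low_degree)
qed (simp add: legendre_inner_smult_left)

text \<open>Integration by parts of \<open>t * L\<close> against \<open>L'\<close> gives an equation between \<open>\<langle>t * L', L\<rangle>\<close> and
  the squared norm. A second one holds because \<open>t * L'\<close> has the leading coefficient of \<open>i * L\<close>.\<close>

lemma legendre_inner_shifted_legendre_self:
  "legendre_inner (shifted_legendre i) (shifted_legendre i) = 1 / (2 * real i + 1)"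
proof -
  define L where "L = shifted_legendre i"
  have "coeff (pCons 0 (pderiv L)) i = real i * coeff L i"
    by (cases i) (simp_all add: coeff_pderiv)
  moreover have "degree (pCons 0 (pderiv L)) \<le> i"
    by (intro degree_le) (auto simp: L_def coeff_pCons coeff_pderiv degree_shifted_legendre
         coeff_eq_0 split: nat.split)
  ultimately have euler: "legendre_inner (pCons 0 (pderiv L)) L = real i * legendre_inner L L"
    unfolding L_def by (intro legendre_inner_shifted_legendre_top) auto
  \<comment> \<open>The 1 is the boundary term \<open>(L 1)\<^sup>2\<close>; at \<open>0\<close> the factor \<open>t\<close> kills it.\<close>
  have "legendre_inner (pCons 0 L) (pderiv L) = 1 - legendre_inner (L + pCons 0 (pderiv L)) L"
    by (simp add: legendre_inner_pderiv_right pderiv_pCons L_def shifted_legendre_at_1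
         flip: power_mult_distrib)
  moreover have "legendre_inner (pCons 0 L) (pderiv L) = legendre_inner (pCons 0 (pderiv L)) L"
    by (simp add: legendre_inner_eq_integral_mult mult.commute)
  ultimately have "(2 * real i + 1) * legendre_inner L L = 1"
    using euler by (simp add: legendre_inner_add_left algebra_simps)
  then show ?thesis by (simp add: L_def field_simps)
qed

lemma legendre_inner_shifted_legendre:
  "legendre_inner (shifted_legendre k) (shifted_legendre i)
     = (if i = k then 1 / (2 * real i + 1) else 0)"
proof (cases i k rule: linorder_cases)
  case less
  then show ?thesis
    by (subst legendre_inner_commute)
       (simp add: legendre_inner_shifted_legendre_low_degree degree_shifted_legendre)
next
  case greater
  then show ?thesis
    by (simp add: legendre_inner_shifted_legendre_low_degree degree_shifted_legendre)
qed (simp add: legendre_inner_shifted_legendre_self)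

section \<open>The dual polynomials extract coefficients\<close>

lemma legendre_inner_shifted_legendre_dual_power:
  assumes "k \<le> n"
  shows "legendre_inner (shifted_legendre k) (dual_power n j) = coeff (shifted_legendre k) j"
proof -
  have "legendre_inner (shifted_legendre k) (dual_power n j)
      = (\<Sum>i = j..n. if i = k then coeff (shifted_legendre k) j else 0)"
    unfolding dual_power_def legendre_inner_sum_right
    by (intro sum.cong) (auto simp: legendre_inner_smult_right legendre_inner_shifted_legendre
         Phi_eq_coeff add_eq_0_iff)
  also have "\<dots> = coeff (shifted_legendre k) j"
    using assms by (simp add: coeff_shifted_legendre_eq_0_iff)
  finally show ?thesis .
qed

text \<open>Both sides are linear in \<open>f\<close> and agree on the shifted Legendre polynomials; since each
  degree contains one of these, leading terms can be removed one at a time.\<close>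

theorem legendre_inner_dual_power:
  assumes "degree f \<le> n"
  shows "legendre_inner f (dual_power n j) = coeff f j"
proof -
  \<comment> \<open>Bounding the support of the coefficients rather than the degree makes the zero polynomial,
    which also has degree 0, a base case of its own.\<close>
  have "legendre_inner f (dual_power n j) = coeff f j" if "\<forall>i\<ge>m. coeff f i = 0" "m \<le> Suc n" for m f
    using that
  proof (induction m arbitrary: f)
    case 0
    then have "f = 0" by (intro poly_eqI) simp
    then show ?case by simp
  next
    case (Suc m)
    define c where "c = coeff f m / coeff (shifted_legendre m) m"
    define r where "r = f - smult c (shifted_legendre m)"
    have "coeff r i = 0" if "i \<ge> m" for i
    proof (cases "i = m")
      case True
      then show ?thesis by (simp add: r_def c_def coeff_shifted_legendre_eq_0_iff)
    next
      case False
      with that Suc.prems(1) show ?thesis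
        by (simp add: r_def coeff_shifted_legendre_eq_0_iff)
    qed
    then have "legendre_inner r (dual_power n j) = coeff r j"
      using Suc by simp
    moreover have "f = smult c (shifted_legendre m) + r" by (simp add: r_def)
    ultimately show ?case
      using Suc.prems(2)
      by (simp add: legendre_inner_add_left legendre_inner_smult_left
            legendre_inner_shifted_legendre_dual_power)
  qed
  from this[of "Suc n" f] show ?thesis using assms by (simp add: coeff_eq_0)
qed

section \<open>Bases\<close>

interpretation poly_space: vector_space "smult :: real \<Rightarrow> real poly \<Rightarrow> real poly"
  by standard (simp_all add: smult_add_left smult_add_right)

text \<open>No \<open>b k\<close> lies in the span of the others, because the kernel of \<open>\<phi> k\<close> is a subspace that
  contains them but not \<open>b k\<close>. For the powers of \<open>t\<close> the functionals are the coefficients, for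
  the dual polynomials they are the inner products with the powers.\<close>

lemma inj_independent_if_dual_functionals:
  fixes b :: "nat \<Rightarrow> real poly" and \<phi> :: "nat \<Rightarrow> real poly \<Rightarrow> real"
  assumes add: "\<And>k p q. \<phi> k (p + q) = \<phi> k p + \<phi> k q"
    and smult: "\<And>k c p. \<phi> k (smult c p) = c * \<phi> k p"
    and delta: "\<And>i j. i \<le> n \<Longrightarrow> j \<le> n \<Longrightarrow> \<phi> i (b j) = (if i = j then 1 else 0)"
  shows "inj_on b {..n} \<and> \<not> module.dependent smult (b ` {..n})"
proof
  show "inj_on b {..n}"
    by (intro inj_onI) (metis atMost_iff delta zero_neq_one)
  show "\<not> module.dependent smult (b ` {..n})"
  proof
    assume "module.dependent smult (b ` {..n})"
    then obtain k where k: "k \<le> n" "b k \<in> poly_space.span (b ` {..n} - {b k})"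
      unfolding poly_space.dependent_def by auto
    have "poly_space.subspace {p. \<phi> k p = 0}"
      using smult[of k 0 0] by (auto intro!: poly_space.subspaceI simp: add smult)
    moreover have "b ` {..n} - {b k} \<subseteq> {p. \<phi> k p = 0}"
      using delta k(1) by auto
    ultimately have "\<phi> k (b k) = 0"
      using poly_space.span_minimal k(2) by blast
    then show False using delta[of k k] k(1) by simp
  qed
qed

lemma span_monom: "poly_space.span ((\<lambda>i. monom 1 i) ` {..n}) = polys_upto n"
proof
  have "poly_space.subspace (polys_upto n)"
    unfolding polys_upto_def
    by (intro poly_space.subspaceI) (auto intro: degree_add_le order_trans[OF degree_smult_le])
  then show "poly_space.span ((\<lambda>i. monom 1 i) ` {..n}) \<subseteq> polys_upto n"
    by (intro poly_space.span_minimal) (auto simp: polys_upto_def degree_monom_eq)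
  show "polys_upto n \<subseteq> poly_space.span ((\<lambda>i. monom 1 i) ` {..n})"
  proof
    fix p assume "p \<in> polys_upto n"
    then have "p = (\<Sum>i\<le>n. smult (coeff p i) (monom 1 i))"
      using poly_as_sum_of_monoms'[of p n] by (simp add: polys_upto_def smult_monom)
    also have "\<dots> \<in> poly_space.span ((\<lambda>i. monom 1 i) ` {..n})"
      by (intro poly_space.span_sum poly_space.span_scale poly_space.span_base) auto
    finally show "p \<in> poly_space.span ((\<lambda>i. monom 1 i) ` {..n})" .
  qed
qed

lemma is_basis_monom: "is_basis (polys_upto n) n (\<lambda>i. monom 1 i)"
  unfolding is_basis_def
  using inj_independent_if_dual_functionals[of "\<lambda>k p. coeff p k" n "\<lambda>i. monom 1 i"] span_monom[of n]
  by simp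

text \<open>A polynomial outside the span of the \<open>d j\<close> could be added to them, giving \<open>n + 2\<close>
  independent vectors in a space spanned by \<open>n + 1\<close>.\<close>

lemma is_basis_if_independent:
  assumes "inj_on d {..n}" "\<not> module.dependent smult (d ` {..n})" "d ` {..n} \<subseteq> polys_upto n"
  shows "is_basis (polys_upto n) n d"
proof -
  let ?M = "(\<lambda>i. monom 1 i) ` {..n} :: real poly set" and ?D = "d ` {..n}"
  have D_M: "?D \<subseteq> poly_space.span ?M"
    using assms(3) by (simp add: span_monom)
  have card: "card ?D = card ?M"
    using is_basis_monom[of n] assms(1) by (simp add: is_basis_def card_image)
  have "p \<in> poly_space.span ?D" if p: "p \<in> poly_space.span ?M" for p
  proof (rule ccontr)
    assume p_D: "p \<notin> poly_space.span ?D"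
    then have "poly_space.independent (insert p ?D)"
      using assms(2) by (rule poly_space.independent_insertI)
    then have "card (insert p ?D) \<le> card ?M"
      using poly_space.independent_span_bound[of ?M "insert p ?D"] p D_M by simp
    moreover have "p \<notin> ?D"
      using p_D poly_space.span_base[of p ?D] by metis
    ultimately show False using card by simp
  qed
  moreover have "poly_space.span ?D \<subseteq> poly_space.span ?M"
    using D_M by (intro poly_space.span_minimal) (auto simp: poly_space.subspace_span)
  ultimately show ?thesis
    using assms(1,2) by (auto simp: is_basis_def span_monom)
qed

lemma degree_dual_power: "degree (dual_power n j) \<le> n"
  unfolding dual_power_def
  by (intro degree_sum_le) (auto intro: order_trans[OF degree_smult_le] simp: degree_shifted_legendre)

theorem lemma4p1:
  fixes n :: nat
  shows "is_dual_basis legendre_inner (polys_upto n) n (\<lambda>i. monom 1 i) (dual_power n)"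
proof -
  have dual: "legendre_inner (monom 1 i) (dual_power n j) = (if i = j then 1 else 0)"
    if "i \<le> n" for i j
    using that by (simp add: legendre_inner_dual_power degree_monom_eq)
  have "is_basis (polys_upto n) n (dual_power n)"
    using inj_independent_if_dual_functionals[of "\<lambda>k. legendre_inner (monom 1 k)" n "dual_power n"]
    by (intro is_basis_if_independent)
       (auto simp: legendre_inner_add_right legendre_inner_smult_right dual polys_upto_def
         degree_dual_power)
  with dual show ?thesis
    by (simp add: is_dual_basis_def is_basis_monom)
qed

end
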